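(* The set $I_{TD^+} = \{e : \mathrm{TD}^+(\mathcal L_e) < \infty\}$ is $\Sigma^0_5$-complete.
   Context: $W_0,W_1,\ldots$ is an acceptable numbering of all r.e. subsets of $\mathbb N$; $L^e_j = \{x : \langle j,x\rangle \in W_e\}$ and $\mathcal L_e = \{L^e_j : j\in\mathbb N\}$. For a family $\mathcal L$ of subsets of $\mathbb N$ and $L\in\mathcal L$, a positive teaching set for $L$ w.r.t. $\mathcal L$ is a set $S\subseteq L$ such that no $L'\in\mathcal L\setminus\{L\}$ satisfies $S\subseteq L'$; $\mathrm{TD}^+(L,\mathcal L)$ is the smallest size of such a set ($\infty$ if there is no finite one), and $\mathrm{TD}^+(\mathcal L)=\sup\{\mathrm{TD}^+(L,\mathcal L):L\in\mathcal L\}$. $\Sigma^0_n$-complete means definable by a $\Sigma^0_n$ formula and every $\Sigma^0_n$ set many-one reduces to it via a recursive function. *)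

theory Defs
  imports Main "HOL-Library.Nat_Bijection" "HOL-Library.Extended_Nat"
begin

text \<open>
  The total (general) recursive functions: the least class containing the basic functions and
  closed under composition, primitive recursion and minimisation of regular functions.
  A \<open>k\<close>-ary function is represented on lists; only its values on lists of length \<open>k\<close> matter,
  which is what the rule \<open>cong\<close> expresses.
\<close>

inductive recursive_fun :: "nat \<Rightarrow> (nat list \<Rightarrow> nat) \<Rightarrow> bool" where
  zero: "recursive_fun k (\<lambda>xs. 0)"
| succ: "recursive_fun 1 (\<lambda>xs. Suc (xs ! 0))"
| proj: "i < k \<Longrightarrow> recursive_fun k (\<lambda>xs. xs ! i)"
| comp: "recursive_fun (length gs) f \<Longrightarrow> (\<forall>g \<in> set gs. recursive_fun k g) \<Longrightarrow>
    recursive_fun k (\<lambda>xs. f (map (\<lambda>g. g xs) gs))"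
| prim_rec: "recursive_fun k f \<Longrightarrow> recursive_fun (Suc (Suc k)) g \<Longrightarrow>
    recursive_fun (Suc k) (\<lambda>xs. rec_nat (f (tl xs)) (\<lambda>n r. g (n # r # tl xs)) (hd xs))"
| mu: "recursive_fun (Suc k) f \<Longrightarrow> (\<forall>xs. length xs = k \<longrightarrow> (\<exists>y. f (y # xs) = 0)) \<Longrightarrow>
    recursive_fun k (\<lambda>xs. LEAST y. f (y # xs) = 0)"
| cong: "recursive_fun k f \<Longrightarrow> (\<forall>xs. length xs = k \<longrightarrow> g xs = f xs) \<Longrightarrow> recursive_fun k g"

definition recursive1 :: "(nat \<Rightarrow> nat) \<Rightarrow> bool" where
  "recursive1 f \<longleftrightarrow> recursive_fun 1 (\<lambda>xs. f (xs ! 0))"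

definition recursive_rel :: "nat \<Rightarrow> (nat list \<Rightarrow> bool) \<Rightarrow> bool" where
  "recursive_rel k R \<longleftrightarrow> recursive_fun k (\<lambda>xs. of_bool (R xs))"

definition re_set :: "nat set \<Rightarrow> bool" where
  "re_set A \<longleftrightarrow> A = {} \<or> (\<exists>f. recursive1 f \<and> A = range f)"

definition uniformly_re :: "(nat \<Rightarrow> nat set) \<Rightarrow> bool" where
  "uniformly_re V \<longleftrightarrow> re_set {prod_encode (e, x) | e x. x \<in> V e}"

text \<open>
  Acceptability in the sense of Rogers: \<open>W\<close> is a uniformly r.e. numbering of exactly the r.e. sets,
  and every uniformly r.e. numbering can be effectively translated into \<open>W\<close>.
\<close>

definition acceptable_numbering :: "(nat \<Rightarrow> nat set) \<Rightarrow> bool" where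
  "acceptable_numbering W \<longleftrightarrow>
     range W = {A. re_set A} \<and>
     uniformly_re W \<and>
     (\<forall>V. uniformly_re V \<longrightarrow> (\<exists>f. recursive1 f \<and> (\<forall>e. V e = W (f e))))"

text \<open>
  \<open>Sigma_form n R xs\<close> is \<open>\<exists>y1. \<forall>y2. \<dots> R (xs @ [y1, y2, \<dots>, yn])\<close>, with \<open>n\<close> alternating
  quantifiers; \<open>Pi_form n R xs\<close> is its dual, starting with \<open>\<forall>\<close>.
\<close>

fun Sigma_form :: "nat \<Rightarrow> (nat list \<Rightarrow> bool) \<Rightarrow> nat list \<Rightarrow> bool"
  and Pi_form :: "nat \<Rightarrow> (nat list \<Rightarrow> bool) \<Rightarrow> nat list \<Rightarrow> bool" where
  "Sigma_form 0 R xs \<longleftrightarrow> R xs"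
| "Sigma_form (Suc n) R xs \<longleftrightarrow> (\<exists>y. Pi_form n R (xs @ [y]))"
| "Pi_form 0 R xs \<longleftrightarrow> R xs"
| "Pi_form (Suc n) R xs \<longleftrightarrow> (\<forall>y. Sigma_form n R (xs @ [y]))"

definition Sigma0_set :: "nat \<Rightarrow> nat set \<Rightarrow> bool" where
  "Sigma0_set n A \<longleftrightarrow> (\<exists>R. recursive_rel (Suc n) R \<and> A = {x. Sigma_form n R [x]})"

definition many_one_reducible :: "nat set \<Rightarrow> nat set \<Rightarrow> bool" (infix "\<le>\<^sub>m" 50) where
  "B \<le>\<^sub>m A \<longleftrightarrow> (\<exists>f. recursive1 f \<and> (\<forall>x. x \<in> B \<longleftrightarrow> f x \<in> A))"

definition Sigma0_complete :: "nat \<Rightarrow> nat set \<Rightarrow> bool" where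
  "Sigma0_complete n A \<longleftrightarrow> Sigma0_set n A \<and> (\<forall>B. Sigma0_set n B \<longrightarrow> B \<le>\<^sub>m A)"

definition positive_teaching_set :: "nat set \<Rightarrow> nat set \<Rightarrow> nat set set \<Rightarrow> bool" where
  "positive_teaching_set S L \<L> \<longleftrightarrow> S \<subseteq> L \<and> \<not> (\<exists>L' \<in> \<L> - {L}. S \<subseteq> L')"

text \<open>In \<^typ>\<open>enat\<close> the infimum of the empty set is \<open>\<infinity>\<close>.\<close>

definition TD_pos :: "nat set \<Rightarrow> nat set set \<Rightarrow> enat" where
  "TD_pos L \<L> = Inf {enat (card S) | S. finite S \<and> positive_teaching_set S L \<L>}"

definition TD_pos_family :: "nat set set \<Rightarrow> enat" where
  "TD_pos_family \<L> = (SUP L \<in> \<L>. TD_pos L \<L>)"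

definition lang :: "(nat \<Rightarrow> nat set) \<Rightarrow> nat \<Rightarrow> nat \<Rightarrow> nat set" where
  "lang W e j = {x. prod_encode (j, x) \<in> W e}"

definition lang_family :: "(nat \<Rightarrow> nat set) \<Rightarrow> nat \<Rightarrow> nat set set" where
  "lang_family W e = range (lang W e)"

definition I_TD_pos :: "(nat \<Rightarrow> nat set) \<Rightarrow> nat set" where
  "I_TD_pos W = {e. TD_pos_family (lang_family W e) < \<infinity>}"

end

theory Submission
  imports Defs
begin

text \<open>
  Upper bound: \<open>TD\<^sup>+ < \<infinity>\<close> says that there is \<open>d\<close> such that for every \<open>j\<close> there is a finite
  \<open>D \<subseteq> L\<^sub>j\<close> with at most \<open>d\<close> elements such that \<open>D \<subseteq> L\<^sub>i\<close> implies \<open>L\<^sub>i = L\<^sub>j\<close> for all \<open>i\<close>. Inclusion of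
  a finite set is \<open>\<Sigma>\<^sub>1\<close> and equality of r.e. sets is \<open>\<Pi>\<^sub>2\<close>, which leaves five quantifiers.

  Hardness: for a \<open>\<Sigma>\<^sub>3\<close> predicate \<open>\<exists>c. \<forall>u. \<exists>v. Q c u v\<close> and a number \<open>a\<close> there is an r.e. gadget whose
  teaching dimension is at most \<open>1\<close> if the predicate holds and exactly \<open>a + 1\<close> otherwise. It has core
  elements \<open>e\<^sub>c\<close> and, for every list \<open>m\<close> of \<open>a\<close> pairs \<open>(c, u)\<close>, a marker \<open>x\<^sub>m\<close>. The list \<open>m\<close> claims that
  each of its \<open>u\<close> is a counterexample for its \<open>c\<close>; it is refuted, a \<open>\<Sigma>\<^sub>1\<close> event, if some \<open>v\<close> with
  \<open>Q c u v\<close> shows up. The base language consists of all \<open>e\<^sub>c\<close> and all refuted \<open>x\<^sub>m\<close>. The language of \<open>m\<close>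
  consists of the \<open>e\<^sub>c\<close> with \<open>c\<close> in \<open>m\<close>, of \<open>x\<^sub>m\<close> and of all refuted markers; it is turned into the base
  language when \<open>m\<close> is refuted, and is otherwise taught by \<open>x\<^sub>m\<close>. If \<open>\<forall>u. \<exists>v. Q c u v\<close>, then \<open>e\<^sub>c\<close> teaches
  the base language, as every list mentioning \<open>c\<close> is refuted; if there is no such \<open>c\<close>, then any \<open>a\<close>
  core elements also lie in the language of an unrefuted list, while \<open>a + 1\<close> of them do not.

  A \<open>\<Sigma>\<^sub>5\<close> set is given by \<open>\<exists>a. \<forall>b. S a b\<close> with \<open>S\<close> in \<open>\<Sigma>\<^sub>3\<close>. For every \<open>a\<close> and every sequence \<open>s\<close> take
  the gadget of \<open>a\<close> and \<open>\<exists>a' \<le> a. S a' (s a')\<close>: if \<open>a\<^sub>0\<close> is a witness, all gadgets with \<open>a \<ge> a\<^sub>0\<close> have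
  dimension at most \<open>1\<close>, and if there is no witness, then every \<open>a\<close> occurs as a lower bound.
\<close>

section \<open>Closure properties of the recursive functions\<close>

definition recursive2 :: "(nat \<Rightarrow> nat \<Rightarrow> nat) \<Rightarrow> bool" where
  "recursive2 h \<longleftrightarrow> recursive_fun 2 (\<lambda>xs. h (xs ! 0) (xs ! 1))"

lemma recursive_fun_comp1:
  assumes "recursive1 h" "recursive_fun k f"
  shows "recursive_fun k (\<lambda>xs. h (f xs))"
  using recursive_fun.comp[of "[f]" "\<lambda>xs. h (xs ! 0)" k] assms
  by (simp add: recursive1_def)

lemma recursive_fun_comp2:
  assumes "recursive2 h" "recursive_fun k f" "recursive_fun k g"
  shows "recursive_fun k (\<lambda>xs. h (f xs) (g xs))"
  using recursive_fun.comp[of "[f, g]" "\<lambda>xs. h (xs ! 0) (xs ! 1)" k] assms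
  by (simp add: recursive2_def numeral_2_eq_2)

lemma recursive1_comp:
  assumes "recursive1 h" "recursive1 f"
  shows "recursive1 (\<lambda>z. h (f z))"
  using recursive_fun_comp1[OF assms(1)] assms(2) by (simp add: recursive1_def)

lemma recursive1_comp2:
  assumes "recursive2 h" "recursive1 f" "recursive1 g"
  shows "recursive1 (\<lambda>z. h (f z) (g z))"
  using recursive_fun_comp2[OF assms(1)] assms(2,3) by (simp add: recursive1_def)

text \<open>Only unary rules are collected, several arguments being packed by pairing;
  \<open>intro recursive\<close> then settles a claim by the shape of its term.\<close>

named_theorems recursive

lemma recursive1_id [recursive]: "recursive1 (\<lambda>z. z)"
  unfolding recursive1_def by (rule recursive_fun.proj) simp

lemma recursive1_Suc: "recursive1 Suc"
  unfolding recursive1_def by (rule recursive_fun.succ)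

lemmas recursive1_Suc_comp [recursive] = recursive1_comp[OF recursive1_Suc]

lemma recursive_fun_const: "recursive_fun k (\<lambda>xs. c)"
proof (induction c)
  case 0
  show ?case by (rule recursive_fun.zero)
next
  case (Suc c)
  show ?case by (rule recursive_fun_comp1[OF recursive1_Suc Suc])
qed

lemma recursive1_const [recursive]: "recursive1 (\<lambda>z. c)"
  unfolding recursive1_def by (rule recursive_fun_const)

lemma recursive2_prim_rec:
  assumes "recursive1 f" "recursive_fun 3 (\<lambda>xs. g (xs ! 0) (xs ! 1) (xs ! 2))"
  shows "recursive2 (\<lambda>n z. rec_nat (f z) (\<lambda>i r. g i r z) n)"
proof -
  have *: "recursive_fun (Suc 1) (\<lambda>xs. rec_nat ((\<lambda>xs. f (xs ! 0)) (tl xs))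
      (\<lambda>n r. (\<lambda>xs. g (xs ! 0) (xs ! 1) (xs ! 2)) (n # r # tl xs)) (hd xs))"
    by (rule recursive_fun.prim_rec) (use assms in \<open>simp_all add: recursive1_def numeral_3_eq_3\<close>)
  show ?thesis
    unfolding recursive2_def numeral_2_eq_2 One_nat_def[symmetric]
    by (rule recursive_fun.cong[OF *]) (auto simp: length_Suc_conv)
qed

lemma recursive2_add: "recursive2 (+)"
proof -
  have "recursive2 (\<lambda>n z. rec_nat z (\<lambda>i r. Suc r) n)"
    by (rule recursive2_prim_rec)
      (auto intro!: recursive recursive_fun_comp1[OF recursive1_Suc] recursive_fun.proj)
  moreover have "rec_nat z (\<lambda>i r. Suc r) n = n + z" for n z
    by (induction n) auto
  ultimately show ?thesis by simp
qed

lemmas recursive1_add [recursive] = recursive1_comp2[OF recursive2_add]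

lemma recursive2_mult: "recursive2 (*)"
proof -
  have "recursive2 (\<lambda>n z. rec_nat 0 (\<lambda>i r. r + z) n)"
    by (rule recursive2_prim_rec)
      (auto intro!: recursive recursive_fun_comp2[OF recursive2_add] recursive_fun.proj)
  moreover have "rec_nat 0 (\<lambda>i r. r + z) n = n * z" for n z
    by (induction n) auto
  ultimately show ?thesis by simp
qed

lemmas recursive1_mult [recursive] = recursive1_comp2[OF recursive2_mult]

lemma recursive1_pred: "recursive1 (\<lambda>z. z - 1)"
proof -
  have "recursive2 (\<lambda>n z. rec_nat 0 (\<lambda>i r. i) n)"
    by (rule recursive2_prim_rec) (auto intro!: recursive recursive_fun.proj)
  moreover have "rec_nat 0 (\<lambda>i r. i) n = n - 1" for n
    by (cases n) auto
  ultimately have "recursive2 (\<lambda>n z. n - 1)" by simp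
  from recursive1_comp2[OF this recursive1_id recursive1_id] show ?thesis .
qed

lemma recursive2_diff: "recursive2 (-)"
proof -
  have "recursive2 (\<lambda>n z. rec_nat z (\<lambda>i r. r - 1) n)"
    by (rule recursive2_prim_rec)
      (auto intro!: recursive recursive_fun_comp1[OF recursive1_pred[simplified]] recursive_fun.proj)
  moreover have "rec_nat z (\<lambda>i r. r - 1) n = z - n" for n z
    by (induction n) auto
  ultimately have "recursive2 (\<lambda>n z. z - n)" by simp
  then have "recursive_fun 2 (\<lambda>xs. xs ! 0 - xs ! 1)"
    by (rule recursive_fun_comp2) (auto intro!: recursive_fun.proj)
  then show ?thesis by (simp add: recursive2_def)
qed

lemmas recursive1_diff [recursive] = recursive1_comp2[OF recursive2_diff]

lemma recursive1_triangle: "recursive1 triangle"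
proof -
  have "recursive2 (\<lambda>n z. rec_nat 0 (\<lambda>i r. r + Suc i) n)"
    by (rule recursive2_prim_rec)
      (auto intro!: recursive recursive_fun_comp2[OF recursive2_add]
        recursive_fun_comp1[OF recursive1_Suc] recursive_fun.proj simp del: add_Suc_right)
  moreover have "rec_nat 0 (\<lambda>i r. r + Suc i) n = triangle n" for n
    by (induction n) auto
  ultimately have "recursive2 (\<lambda>n z. triangle n)" by simp
  from recursive1_comp2[OF this recursive1_id recursive1_id] show ?thesis .
qed

lemmas recursive1_triangle_comp [recursive] = recursive1_comp[OF recursive1_triangle]

section \<open>Cantor pairing and its projections\<close>

abbreviation pr :: "nat \<Rightarrow> nat \<Rightarrow> nat" where
  "pr a b \<equiv> prod_encode (a, b)"

definition pfst :: "nat \<Rightarrow> nat" where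
  "pfst z = fst (prod_decode z)"

definition psnd :: "nat \<Rightarrow> nat" where
  "psnd z = snd (prod_decode z)"

lemma pfst_pr [simp]: "pfst (pr a b) = a"
  and psnd_pr [simp]: "psnd (pr a b) = b"
  and pr_pfst_psnd [simp]: "pr (pfst z) (psnd z) = z"
  by (simp_all add: pfst_def psnd_def)

lemma recursive2_pr: "recursive2 pr"
  unfolding recursive2_def prod_encode_def prod.case
  by (intro recursive_fun_comp2[OF recursive2_add] recursive_fun_comp1[OF recursive1_triangle]
      recursive_fun.proj) simp_all

lemmas recursive1_pr [recursive] = recursive1_comp2[OF recursive2_pr]

lemma mono_triangle: "m \<le> n \<Longrightarrow> triangle m \<le> triangle n"
  by (induction n rule: dec_induct) auto

text \<open>The sum \<open>a + b\<close> of the components of \<open>pr a b\<close>, found by an unbounded search.\<close>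

definition psum :: "nat \<Rightarrow> nat" where
  "psum z = (LEAST s. Suc z - triangle (Suc s) = 0)"

text \<open>\<open>pr a b\<close> is \<open>triangle (a + b) + a\<close>, hence below
  \<open>triangle (Suc (a + b))\<close> but not below \<open>triangle (a + b)\<close>; the truncated
  difference vanishes exactly when \<open>triangle (Suc s)\<close> exceeds the code.\<close>

lemma psum_pr: "psum (pr a b) = a + b"
  unfolding psum_def
proof (rule Least_equality)
  show "Suc (pr a b) - triangle (Suc (a + b)) = 0"
    by (simp add: prod_encode_def)
next
  fix s assume s: "Suc (pr a b) - triangle (Suc s) = 0"
  show "a + b \<le> s"
  proof (rule ccontr)
    assume "\<not> a + b \<le> s"
    then have "triangle (Suc s) \<le> triangle (a + b)" by (intro mono_triangle) simp
    with s show False by (simp add: prod_encode_def)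
  qed
qed

lemma recursive1_psum [recursive]: "recursive1 psum"
proof -
  have f: "recursive_fun (Suc 1) (\<lambda>xs. Suc (xs ! 1) - triangle (Suc (xs ! 0)))"
    by (intro recursive_fun_comp2[OF recursive2_diff] recursive_fun_comp1[OF recursive1_triangle]
        recursive_fun_comp1[OF recursive1_Suc] recursive_fun.proj) simp_all
  have ex: "\<exists>y. Suc z - triangle (Suc y) = 0" for z
  proof -
    have "z \<le> triangle z" by (induction z) auto
    then show ?thesis by (intro exI[of _ z]) simp
  qed
  have "recursive_fun 1 (\<lambda>xs. LEAST y. (\<lambda>xs. Suc (xs ! 1) - triangle (Suc (xs ! 0))) (y # xs) = 0)"
    by (rule recursive_fun.mu[OF f]) (use ex in simp)
  then show ?thesis by (simp add: recursive1_def psum_def)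
qed

lemma recursive1_pfst: "recursive1 pfst"
proof -
  have "pfst = (\<lambda>z. z - triangle (psum z))"
  proof
    fix z
    have "z = triangle (psum z) + pfst z"
      using psum_pr[of "pfst z" "psnd z"] pr_pfst_psnd[of z]
      unfolding prod_encode_def by (metis case_prod_conv pr_pfst_psnd)
    then show "pfst z = z - triangle (psum z)" by simp
  qed
  moreover have "recursive1 (\<lambda>z. z - triangle (psum z))"
    by (intro recursive)
  ultimately show ?thesis by simp
qed

lemmas recursive1_pfst_comp [recursive] = recursive1_comp[OF recursive1_pfst]

lemma recursive1_psnd: "recursive1 psnd"
proof -
  have "psnd = (\<lambda>z. psum z - pfst z)"
    using psum_pr[of "pfst z" "psnd z" for z] by (auto simp: fun_eq_iff)
  moreover have "recursive1 (\<lambda>z. psum z - pfst z)"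
    by (intro recursive)
  ultimately show ?thesis by simp
qed

lemmas recursive1_psnd_comp [recursive] = recursive1_comp[OF recursive1_psnd]

lemma recursive1_list_comp:
  assumes "recursive_fun (length gs) f" "\<forall>g \<in> set gs. recursive1 g"
  shows "recursive1 (\<lambda>z. f (map (\<lambda>g. g z) gs))"
proof -
  have "recursive_fun 1 (\<lambda>xs. f (map (\<lambda>h. h xs) (map (\<lambda>g xs. g (xs ! 0)) gs)))"
    by (rule recursive_fun.comp) (use assms in \<open>auto simp: recursive1_def\<close>)
  then show ?thesis by (simp add: recursive1_def o_def)
qed

lemma recursive1_prim_rec:
  assumes "recursive1 f" "recursive1 (\<lambda>w. g (pfst w) (pfst (psnd w)) (psnd (psnd w)))" "recursive1 h"
  shows "recursive1 (\<lambda>z. rec_nat (f z) (\<lambda>i r. g i r z) (h z))"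
proof -
  have "recursive_fun 3 (\<lambda>xs. (\<lambda>w. g (pfst w) (pfst (psnd w)) (psnd (psnd w)))
      (pr (xs ! 0) (pr (xs ! 1) (xs ! 2))))"
    by (intro recursive_fun_comp1[OF assms(2)] recursive_fun_comp2[OF recursive2_pr]
        recursive_fun.proj) simp_all
  then have "recursive2 (\<lambda>n z. rec_nat (f z) (\<lambda>i r. g i r z) n)"
    by (intro recursive2_prim_rec[OF assms(1)]) simp
  from recursive1_comp2[OF this assms(3) recursive1_id] show ?thesis .
qed

section \<open>Decidable predicates\<close>

definition decidable :: "(nat \<Rightarrow> bool) \<Rightarrow> bool" where
  "decidable P \<longleftrightarrow> recursive1 (\<lambda>z. of_bool (P z))"

lemma decidable_not [recursive]: "decidable P \<Longrightarrow> decidable (\<lambda>z. \<not> P z)"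
proof -
  assume "decidable P"
  then have "recursive1 (\<lambda>z. 1 - of_bool (P z))"
    unfolding decidable_def by (intro recursive)
  moreover have "1 - of_bool Q = (of_bool (\<not> Q) :: nat)" for Q by simp
  ultimately show ?thesis unfolding decidable_def by simp
qed

lemma decidable_conj [recursive]:
  assumes "decidable P" "decidable Q"
  shows "decidable (\<lambda>z. P z \<and> Q z)"
  using assms unfolding decidable_def of_bool_conj by (intro recursive)

lemma decidable_disj [recursive]:
  assumes "decidable P" "decidable Q"
  shows "decidable (\<lambda>z. P z \<or> Q z)"
proof -
  have "decidable (\<lambda>z. \<not> (\<not> P z \<and> \<not> Q z))" using assms by (intro recursive)
  then show ?thesis by simp
qed

lemma decidable_imp [recursive]:
  assumes "decidable P" "decidable Q"
  shows "decidable (\<lambda>z. P z \<longrightarrow> Q z)"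
  unfolding imp_conv_disj using assms by (intro recursive)

lemma decidable_le [recursive]:
  assumes "recursive1 f" "recursive1 g"
  shows "decidable (\<lambda>z. f z \<le> g z)"
proof -
  have "recursive1 (\<lambda>z. 1 - (f z - g z))" using assms by (intro recursive)
  moreover have "1 - (m - n) = of_bool (m \<le> n)" for m n :: nat by auto
  ultimately show ?thesis by (simp add: decidable_def)
qed

lemma decidable_eq [recursive]:
  assumes "recursive1 f" "recursive1 g"
  shows "decidable (\<lambda>z. f z = g z)"
  unfolding order_eq_iff using assms by (intro recursive)

lemma decidable_ball [recursive]:
  assumes "recursive1 f" "decidable (\<lambda>w. P (pfst w) (psnd w))"
  shows "decidable (\<lambda>z. \<forall>i < f z. P i z)"
proof -
  have "recursive1 (\<lambda>z. of_bool (P (pfst z) (psnd z)))"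
    using assms(2) by (simp add: decidable_def)
  \<comment> \<open>The recursion step sees index, accumulator and parameter; the test has to skip
    the accumulator.\<close>
  from recursive1_comp[OF this, of "\<lambda>w. pr (pfst w) (psnd (psnd w))"]
  have "recursive1 (\<lambda>w. of_bool (P (pfst w) (psnd (psnd w))))"
    by (simp add: recursive)
  then have "recursive1 (\<lambda>z. rec_nat 1 (\<lambda>i r. r * of_bool (P i z)) (f z))"
    by (intro recursive1_prim_rec recursive assms)
  moreover have "rec_nat 1 (\<lambda>i r. r * of_bool (P i z)) n = (of_bool (\<forall>i<n. P i z) :: nat)" for z n
    by (induction n) (auto simp: less_Suc_eq)
  ultimately show ?thesis by (simp add: decidable_def)
qed

lemma decidable_bex [recursive]:
  assumes "recursive1 f" "decidable (\<lambda>w. P (pfst w) (psnd w))"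
  shows "decidable (\<lambda>z. \<exists>i < f z. P i z)"
proof -
  have "decidable (\<lambda>z. \<not> (\<forall>i < f z. \<not> P i z))"
    using assms by (intro recursive)
  then show ?thesis by simp
qed

text \<open>Repeated unpairing reads \<open>s\<close> as an infinite sequence. No length is stored,
  and every finite sequence is a prefix of a coded one.\<close>

definition dec :: "nat \<Rightarrow> nat \<Rightarrow> nat" where
  "dec s i = pfst ((psnd ^^ i) s)"

lemma dec_surj: "\<exists>s. \<forall>i<n. dec s i = F i"
proof (induction n arbitrary: F)
  case (Suc n)
  obtain s where s: "dec s i = F (Suc i)" if "i < n" for i
    using Suc.IH[of "\<lambda>i. F (Suc i)"] by blast
  have "dec (pr (F 0) s) i = F i" if "i < Suc n" for i
    using that s by (cases i) (simp_all add: dec_def funpow_Suc_right del: funpow.simps(2))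
  then show ?case by (intro exI[of _ "pr (F 0) s"]) simp
qed simp

lemma recursive1_dec [recursive]:
  assumes "recursive1 f" "recursive1 g"
  shows "recursive1 (\<lambda>z. dec (f z) (g z))"
proof -
  have "recursive1 (\<lambda>z. pfst (rec_nat (f z) (\<lambda>i r. psnd r) (g z)))"
    using assms by (intro recursive recursive1_prim_rec)
  moreover have "rec_nat s (\<lambda>i r. psnd r) n = (psnd ^^ n) s" for s n
    by (induction n) auto
  ultimately show ?thesis by (simp add: dec_def)
qed

lemma re_set_projection:
  assumes "decidable (\<lambda>z. P (pfst z) (psnd z))"
  shows "re_set {y. \<exists>t. P y t}"
proof (cases "{y. \<exists>t. P y t} = {}")
  case False
  then obtain a s where a: "P a s" by blast
  let ?b = "\<lambda>z. of_bool (P (pfst z) (psnd z)) :: nat"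
  \<comment> \<open>A pair that passes the test yields its first component, any other the default
    \<open>a\<close>, so that the enumeration is total.\<close>
  let ?f = "\<lambda>z. ?b z * pfst z + (1 - ?b z) * a"
  have "recursive1 ?f"
    using assms unfolding decidable_def by (intro recursive)
  moreover have "range ?f = {y. \<exists>t. P y t}"
  proof (intro equalityI subsetI)
    fix y assume "y \<in> range ?f"
    then show "y \<in> {y. \<exists>t. P y t}" using a by (auto simp: of_bool_def split: if_splits)
  next
    fix y assume "y \<in> {y. \<exists>t. P y t}"
    then obtain t where "P y t" by blast
    then have "y = ?f (pr y t)" by simp
    then show "y \<in> range ?f" by blast
  qed
  ultimately show ?thesis unfolding re_set_def by metis
qed (simp add: re_set_def)

section \<open>Bounded teaching dimension\<close>

text \<open>Infima of nonempty sets of \<open>enat\<close> are attained, and a finite bound excludes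
  the empty set.\<close>

lemma TD_pos_le_iff:
  "TD_pos L F \<le> enat d \<longleftrightarrow> (\<exists>S. finite S \<and> card S \<le> d \<and> positive_teaching_set S L F)"
proof
  assume le: "TD_pos L F \<le> enat d"
  let ?A = "{enat (card S) | S. finite S \<and> positive_teaching_set S L F}"
  have "?A \<noteq> {}"
  proof
    assume "?A = {}"
    then have "TD_pos L F = \<infinity>" unfolding TD_pos_def by (simp only: Inf_enat_def simp_thms if_True)
    with le show False by simp
  qed
  then have "Inf ?A \<in> ?A"
    unfolding Inf_enat_def by (metis (no_types, lifting) LeastI ex_in_conv)
  then obtain S where "Inf ?A = enat (card S)" "finite S" "positive_teaching_set S L F"
    by blast
  then show "\<exists>S. finite S \<and> card S \<le> d \<and> positive_teaching_set S L F"
    using le unfolding TD_pos_def by (intro exI[of _ S]) simp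
next
  assume "\<exists>S. finite S \<and> card S \<le> d \<and> positive_teaching_set S L F"
  then obtain S where "finite S" "card S \<le> d" "positive_teaching_set S L F" by blast
  then show "TD_pos L F \<le> enat d"
    unfolding TD_pos_def by (intro Inf_lower2[of "enat (card S)"]) auto
qed

lemma TD_pos_family_finite_iff:
  "TD_pos_family F < \<infinity> \<longleftrightarrow>
    (\<exists>d. \<forall>L\<in>F. \<exists>S. finite S \<and> card S \<le> d \<and> positive_teaching_set S L F)"
  unfolding TD_pos_le_iff[symmetric]
proof
  assume "TD_pos_family F < \<infinity>"
  then obtain d where "TD_pos_family F = enat d" by auto
  then have "\<forall>L\<in>F. TD_pos L F \<le> enat d"
    unfolding TD_pos_family_def by (metis SUP_upper)
  then show "\<exists>d. \<forall>L\<in>F. TD_pos L F \<le> enat d" ..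
next
  assume "\<exists>d. \<forall>L\<in>F. TD_pos L F \<le> enat d"
  then obtain d where "\<forall>L\<in>F. TD_pos L F \<le> enat d" ..
  then have "TD_pos_family F \<le> enat d"
    unfolding TD_pos_family_def by (auto intro: SUP_least)
  then show "TD_pos_family F < \<infinity>"
    by (rule le_less_trans) simp
qed

text \<open>Finite sets become prefixes of coded sequences. Repetitions only lower the cardinality,
  so bounding the length amounts to bounding the cardinality.\<close>

lemma I_TD_pos_iff:
  "e \<in> I_TD_pos W \<longleftrightarrow> (\<exists>d. \<forall>j. \<exists>l S. l \<le> d \<and> dec S ` {..<l} \<subseteq> lang W e j \<and>
    (\<forall>i. dec S ` {..<l} \<subseteq> lang W e i \<longrightarrow> lang W e i = lang W e j))"
proof -
  have bounded: "(\<exists>D. finite D \<and> card D \<le> d \<and> Q D) \<longleftrightarrow> (\<exists>l S. l \<le> d \<and> Q (dec S ` {..<l}))"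
    for d and Q :: "nat set \<Rightarrow> bool"
  proof
    assume "\<exists>D. finite D \<and> card D \<le> d \<and> Q D"
    then obtain D where D: "finite D" "card D \<le> d" "Q D" by blast
    from ex_bij_betw_nat_finite[OF D(1)] obtain h where "bij_betw h {..<card D} D"
      by (auto simp: atLeast0LessThan)
    moreover obtain S where "\<forall>i<card D. dec S i = h i" using dec_surj by blast
    ultimately have "dec S ` {..<card D} = D" by (auto simp: bij_betw_def)
    with D show "\<exists>l S. l \<le> d \<and> Q (dec S ` {..<l})" by metis
  next
    assume "\<exists>l S. l \<le> d \<and> Q (dec S ` {..<l})"
    then obtain l S where "l \<le> d" "Q (dec S ` {..<l})" by blast
    moreover have "card (dec S ` {..<l}) \<le> l"
      using card_image_le[of "{..<l}" "dec S"] by simp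
    ultimately show "\<exists>D. finite D \<and> card D \<le> d \<and> Q D"
      by (intro exI[of _ "dec S ` {..<l}"]) auto
  qed
  have "positive_teaching_set D (lang W e j) (range (lang W e)) \<longleftrightarrow> D \<subseteq> lang W e j \<and>
      (\<forall>i. D \<subseteq> lang W e i \<longrightarrow> lang W e i = lang W e j)" for D j
    unfolding positive_teaching_set_def by auto
  then show ?thesis
    unfolding I_TD_pos_def mem_Collect_eq TD_pos_family_finite_iff lang_family_def bounded
    by simp
qed

section \<open>Five-quantifier normal forms\<close>

lemma Sigma0_set_5I:
  assumes "decidable (\<lambda>z. P (pfst z) (pfst (psnd z)) (pfst (psnd (psnd z)))
    (pfst (psnd (psnd (psnd z)))) (pfst (psnd (psnd (psnd (psnd z)))))
    (psnd (psnd (psnd (psnd (psnd z))))))"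
  shows "Sigma0_set 5 {x. \<exists>a. \<forall>b. \<exists>c. \<forall>d. \<exists>e. P x a b c d e}"
proof -
  let ?R = "\<lambda>xs. P (xs ! 0) (xs ! 1) (xs ! 2) (xs ! 3) (xs ! 4) (xs ! 5)"
  have "recursive_fun 6 (\<lambda>xs. (\<lambda>z. of_bool (P (pfst z) (pfst (psnd z)) (pfst (psnd (psnd z)))
    (pfst (psnd (psnd (psnd z)))) (pfst (psnd (psnd (psnd (psnd z)))))
    (psnd (psnd (psnd (psnd (psnd z))))))) (pr (xs ! 0) (pr (xs ! 1) (pr (xs ! 2) (pr (xs ! 3)
    (pr (xs ! 4) (xs ! 5)))))))"
    by (intro recursive_fun_comp1[OF assms[unfolded decidable_def]]
        recursive_fun_comp2[OF recursive2_pr] recursive_fun.proj) simp_all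
  then have "recursive_rel (Suc 5) ?R"
    by (simp add: recursive_rel_def)
  moreover have "Sigma_form 5 ?R [x] \<longleftrightarrow> (\<exists>a. \<forall>b. \<exists>c. \<forall>d. \<exists>e. P x a b c d e)" for x
    by (simp add: eval_nat_numeral)
  ultimately show ?thesis
    unfolding Sigma0_set_def by (intro exI[of _ ?R]) simp
qed

text \<open>Decidability is given for arbitrary recursive arguments, so that it can serve as an
  introduction rule next to \<open>recursive\<close>.\<close>

lemma Sigma0_set_5E:
  assumes "Sigma0_set 5 A"
  obtains P where "A = {x. \<exists>a. \<forall>b. \<exists>c. \<forall>d. \<exists>e. P x a b c d e}"
    and "\<And>f0 f1 f2 f3 f4 f5. \<lbrakk>recursive1 f0; recursive1 f1; recursive1 f2; recursive1 f3;
      recursive1 f4; recursive1 f5\<rbrakk> \<Longrightarrow> decidable (\<lambda>z. P (f0 z) (f1 z) (f2 z) (f3 z) (f4 z) (f5 z))"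
proof -
  from assms obtain R where R: "recursive_rel 6 R" and A: "A = {x. Sigma_form 5 R [x]}"
    by (auto simp: Sigma0_set_def)
  show thesis
  proof (rule that[of "\<lambda>x a b c d e. R [x, a, b, c, d, e]"])
    show "A = {x. \<exists>a. \<forall>b. \<exists>c. \<forall>d. \<exists>e. R [x, a, b, c, d, e]}"
      unfolding A by (simp add: eval_nat_numeral)
  next
    fix f0 f1 f2 f3 f4 f5
    assume "recursive1 f0" "recursive1 f1" "recursive1 f2" "recursive1 f3" "recursive1 f4"
      "recursive1 f5"
    then show "decidable (\<lambda>z. R [f0 z, f1 z, f2 z, f3 z, f4 z, f5 z])"
      using recursive1_list_comp[of "[f0, f1, f2, f3, f4, f5]" "\<lambda>xs. of_bool (R xs)"] R
      by (simp add: recursive_rel_def decidable_def eval_nat_numeral)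
  qed
qed

text \<open>Merges adjacent quantifiers of one kind, so that only alternations count.\<close>

lemma ex_pair: "(\<exists>s. Q (pfst s) (psnd s)) \<longleftrightarrow> (\<exists>a b. Q a b)"
proof
  assume "\<exists>a b. Q a b"
  then obtain a b where "Q a b" by blast
  then show "\<exists>s. Q (pfst s) (psnd s)" by (intro exI[of _ "pr a b"]) simp
qed blast

lemma all_pair: "(\<forall>s. Q (pfst s) (psnd s)) \<longleftrightarrow> (\<forall>a b. Q a b)"
  using ex_pair[of "\<lambda>a b. \<not> Q a b"] by blast

section \<open>The upper bound\<close>

lemma uniformly_re_enumeration:
  assumes "acceptable_numbering W"
  obtains g where "recursive1 g" "\<And>e x. x \<in> W e \<longleftrightarrow> (\<exists>t. g t = pr e x)"
proof -
  let ?G = "{pr e x | e x. x \<in> W e}"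
  \<comment> \<open>The empty r.e. set has no enumerating function; the occurrence of
    \<open>{0}\<close> in the numbering excludes this case.\<close>
  have "re_set (range (\<lambda>x::nat. 0))"
    unfolding re_set_def using recursive1_const by blast
  then have "range (\<lambda>x::nat. 0) \<in> range W"
    using assms unfolding acceptable_numbering_def by blast
  then have "?G \<noteq> {}" by auto
  moreover have "re_set ?G"
    using assms by (simp add: acceptable_numbering_def uniformly_re_def)
  ultimately obtain g where g: "recursive1 g" "?G = range g"
    unfolding re_set_def by blast
  have "x \<in> W e \<longleftrightarrow> (\<exists>t. g t = pr e x)" for e x
  proof -
    have "x \<in> W e \<longleftrightarrow> pr e x \<in> ?G" by auto
    also have "\<dots> \<longleftrightarrow> (\<exists>t. g t = pr e x)" unfolding g(2) by (metis rangeE rangeI)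
    finally show ?thesis .
  qed
  with g(1) show thesis by (rule that)
qed

lemma Sigma0_set_I_TD_pos:
  assumes "acceptable_numbering W"
  shows "Sigma0_set 5 (I_TD_pos W)"
proof -
  obtain g where g: "recursive1 g" and W: "\<And>e x. x \<in> W e \<longleftrightarrow> (\<exists>t. g t = pr e x)"
    using that by (rule uniformly_re_enumeration[OF assms])
  note [recursive] = recursive1_comp[OF g]
  \<comment> \<open>In \<open>wit\<close>, \<open>t\<close> codes stages at which the first
    \<open>l\<close> entries of \<open>S\<close> enter language \<open>k\<close>; in
    \<open>sim\<close>, whatever stage \<open>t\<close> puts into language \<open>i\<close>, stage
    \<open>r\<close> puts into language \<open>j\<close>.\<close>
  define wit where "wit e k l S t \<longleftrightarrow> (\<forall>i<l. g (dec t i) = pr e (pr k (dec S i)))" for e k l S t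
  define sim where "sim e i j t r \<longleftrightarrow>
    (g t = pr e (pr i (psnd (psnd (g t)))) \<longrightarrow> g r = pr e (pr j (psnd (psnd (g t)))))" for e i j t r
  \<comment> \<open>\<open>s\<close> packs length, set code and its stages; \<open>q\<close> packs a
    competitor \<open>i\<close>, stages \<open>w\<close> for it and a stage \<open>t\<close>;
    \<open>r\<close> packs the answers for both inclusions.\<close>
  define P where "P e d j s q r \<longleftrightarrow> pfst s \<le> d \<and>
      wit e j (pfst s) (pfst (psnd s)) (psnd (psnd s)) \<and>
      (wit e (pfst q) (pfst s) (pfst (psnd s)) (pfst (psnd q)) \<longrightarrow>
        sim e (pfst q) j (psnd (psnd q)) (pfst r) \<and> sim e j (pfst q) (psnd (psnd q)) (psnd r))"
    for e d j s q r
  have subset_wit_iff: "dec S ` {..<l} \<subseteq> lang W e k \<longleftrightarrow> (\<exists>t. wit e k l S t)" for e k l S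
  proof
    assume "dec S ` {..<l} \<subseteq> lang W e k"
    then have "\<forall>i. \<exists>t. i < l \<longrightarrow> g t = pr e (pr k (dec S i))"
      by (auto simp: lang_def W)
    then obtain h where "\<forall>i<l. g (h i) = pr e (pr k (dec S i))" by metis
    moreover obtain t where "\<forall>i<l. dec t i = h i" using dec_surj by blast
    ultimately show "\<exists>t. wit e k l S t" by (intro exI[of _ t]) (simp add: wit_def)
  qed (auto simp: lang_def W wit_def)
  have sim_iff: "(\<forall>t. \<exists>r. sim e i j t r) \<longleftrightarrow> lang W e i \<subseteq> lang W e j" for e i j
    unfolding sim_def lang_def W by (auto; metis psnd_pr)
  have eq_iff: "(\<forall>t. \<exists>r r'. sim e i j t r \<and> sim e j i t r') \<longleftrightarrow> lang W e i = lang W e j" for e i j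
    using sim_iff[of e i j] sim_iff[of e j i] by blast
  have "I_TD_pos W = {e. \<exists>d. \<forall>j. \<exists>s. \<forall>q. \<exists>r. P e d j s q r}"
  proof (intro set_eqI)
    fix e
    \<comment> \<open>The inclusion test is an existential premise, so its witness \<open>w\<close>
      becomes universal and joins \<open>i\<close> and \<open>t\<close>.\<close>
    have inner: "(\<forall>i w t. \<exists>r r'. A \<and> C \<and> (wit e i l S w \<longrightarrow> sim e i j t r \<and> sim e j i t r')) \<longleftrightarrow>
        A \<and> C \<and> (\<forall>i. dec S ` {..<l} \<subseteq> lang W e i \<longrightarrow> lang W e i = lang W e j)" for A C l S j
      unfolding subset_wit_iff eq_iff[symmetric] by blast
    have "(\<exists>d. \<forall>j. \<exists>s. \<forall>q. \<exists>r. P e d j s q r) \<longleftrightarrow>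
       (\<exists>d. \<forall>j. \<exists>l S u. \<forall>i w t. \<exists>r r'. l \<le> d \<and> wit e j l S u \<and>
         (wit e i l S w \<longrightarrow> sim e i j t r \<and> sim e j i t r'))"
      unfolding P_def
      by (subst ex_pair, subst all_pair, subst all_pair, subst ex_pair, subst ex_pair) (rule refl)
    also have "\<dots> \<longleftrightarrow> e \<in> I_TD_pos W"
      unfolding inner I_TD_pos_iff by (simp add: subset_wit_iff)
    finally show "e \<in> I_TD_pos W \<longleftrightarrow> e \<in> {e. \<exists>d. \<forall>j. \<exists>s. \<forall>q. \<exists>r. P e d j s q r}"
      by simp
  qed
  also have "Sigma0_set 5 \<dots>"
    unfolding P_def wit_def sim_def by (intro Sigma0_set_5I recursive)
  finally show ?thesis .
qed

section \<open>Hardness\<close>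

text \<open>
  A gadget is indexed by \<open>p = pr a s\<close>, and the list \<open>m\<close> is coded by \<open>dec m i = pr c\<^sub>i u\<^sub>i\<close> for \<open>i < a\<close>.
\<close>

definition refuted :: "(nat \<Rightarrow> nat \<Rightarrow> nat \<Rightarrow> nat \<Rightarrow> bool) \<Rightarrow> nat \<Rightarrow> nat \<Rightarrow> nat \<Rightarrow> bool" where
  "refuted Q p m v \<longleftrightarrow> (\<exists>i < pfst p. Q p (pfst (dec m i)) (psnd (dec m i)) v)"

abbreviation core :: "nat \<Rightarrow> nat \<Rightarrow> nat" where
  "core p c \<equiv> pr p (pr 0 c)"

abbreviation marker :: "nat \<Rightarrow> nat \<Rightarrow> nat" where
  "marker p m \<equiv> pr p (pr (Suc 0) m)"

text \<open>
  The language \<open>pr p 0\<close> is the base language of the gadget \<open>p\<close>, and \<open>pr p (Suc m)\<close> is the language of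
  the list \<open>m\<close>.
\<close>

definition gadget_at ::
    "(nat \<Rightarrow> nat \<Rightarrow> nat \<Rightarrow> nat \<Rightarrow> bool) \<Rightarrow> nat \<Rightarrow> nat \<Rightarrow> nat \<Rightarrow> nat \<Rightarrow> nat \<Rightarrow> bool" where
  "gadget_at Q p k b n v \<longleftrightarrow>
    b = 0 \<and> (k = 0 \<or> refuted Q p (k - 1) v \<or> (\<exists>i < pfst p. pfst (dec (k - 1) i) = n)) \<or>
    b = Suc 0 \<and> (refuted Q p n v \<or> k = Suc n)"

text \<open>The tag \<open>p\<close> on elements keeps different gadgets disjoint. All unbounded
  search sits in the single \<open>v\<close>, which makes the family uniformly r.e.\<close>

definition gadget :: "(nat \<Rightarrow> nat \<Rightarrow> nat \<Rightarrow> nat \<Rightarrow> bool) \<Rightarrow> nat \<Rightarrow> nat set" where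
  "gadget Q j = {y. \<exists>v. pfst j = pfst y \<and>
    gadget_at Q (pfst j) (psnd j) (pfst (psnd y)) (psnd (psnd y)) v}"

lemma core_in_gadget:
  "core p' c \<in> gadget Q (pr p k) \<longleftrightarrow> p' = p \<and>
    (k = 0 \<or> (\<exists>v. refuted Q p (k - 1) v) \<or> (\<exists>i < pfst p. pfst (dec (k - 1) i) = c))"
  by (auto simp: gadget_def gadget_at_def)

lemma marker_in_gadget:
  "marker p' m \<in> gadget Q (pr p k) \<longleftrightarrow> p' = p \<and> ((\<exists>v. refuted Q p m v) \<or> k = Suc m)"
  by (auto simp: gadget_def gadget_at_def)

lemma gadget_cases:
  assumes "y \<in> gadget Q (pr p k)"
  obtains c where "y = core p c" | m where "y = marker p m"
proof -
  have "y = pr p (pr (pfst (psnd y)) (psnd (psnd y)))" "pfst (psnd y) = 0 \<or> pfst (psnd y) = Suc 0"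
    using assms by (auto simp: gadget_def gadget_at_def)
  then show thesis using that by metis
qed

text \<open>Refutation puts all core elements into the language of \<open>m\<close> and its marker
  into every language of the gadget, which removes all differences.\<close>

lemma gadget_refuted:
  assumes "refuted Q p m v"
  shows "gadget Q (pr p (Suc m)) = gadget Q (pr p 0)"
proof (intro set_eqI iffI)
  fix y assume y: "y \<in> gadget Q (pr p (Suc m))"
  then show "y \<in> gadget Q (pr p 0)"
    by (cases rule: gadget_cases) (use y assms in \<open>auto simp: core_in_gadget marker_in_gadget\<close>)
next
  fix y assume y: "y \<in> gadget Q (pr p 0)"
  then show "y \<in> gadget Q (pr p (Suc m))"
    by (cases rule: gadget_cases) (use y assms in \<open>auto simp: core_in_gadget marker_in_gadget\<close>)
qed

lemma positive_teaching_set_rangeI: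
  assumes "S \<subseteq> gadget Q j" "\<And>p k. S \<subseteq> gadget Q (pr p k) \<Longrightarrow> gadget Q (pr p k) = gadget Q j"
  shows "positive_teaching_set S (gadget Q j) (range (gadget Q))"
  unfolding positive_teaching_set_def
proof (intro conjI notI assms(1))
  assume "\<exists>L' \<in> range (gadget Q) - {gadget Q j}. S \<subseteq> L'"
  then obtain i where "gadget Q i \<noteq> gadget Q j" "S \<subseteq> gadget Q i" by blast
  with assms(2)[of "pfst i" "psnd i"] show False by simp
qed

section \<open>Teaching sets in the gadgets\<close>

lemma teach_unrefuted:
  assumes "\<nexists>v. refuted Q p m v"
  shows "positive_teaching_set {marker p m} (gadget Q (pr p (Suc m))) (range (gadget Q))"
  by (rule positive_teaching_set_rangeI) (use assms in \<open>auto simp: marker_in_gadget\<close>)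

lemma teach_base_singleton:
  assumes "\<forall>u. \<exists>v. Q p c u v"
  shows "positive_teaching_set {core p c} (gadget Q (pr p 0)) (range (gadget Q))"
proof (rule positive_teaching_set_rangeI)
  fix p' k assume "{core p c} \<subseteq> gadget Q (pr p' k)"
  then have p': "p' = p" and
    k: "k = 0 \<or> (\<exists>v. refuted Q p (k - 1) v) \<or> (\<exists>i < pfst p. pfst (dec (k - 1) i) = c)"
    by (auto simp: core_in_gadget)
  \<comment> \<open>An entry of the list with first component \<open>c\<close> has some
    \<open>u\<close>, for which the assumption supplies a refuting \<open>v\<close>.\<close>
  from k assms have "k = 0 \<or> (\<exists>v. refuted Q p (k - 1) v)"
    unfolding refuted_def by blast
  then show "gadget Q (pr p' k) = gadget Q (pr p 0)"
    using gadget_refuted[of Q p "k - 1"] p' by (cases k) auto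
qed (simp add: core_in_gadget)

text \<open>Pigeonhole: a list of \<open>pfst p\<close> pairs cannot mention
  \<open>Suc (pfst p)\<close> core indices. This holds for every \<open>Q\<close>.\<close>

lemma teach_base:
  "positive_teaching_set (core p ` {..pfst p}) (gadget Q (pr p 0)) (range (gadget Q))"
proof (rule positive_teaching_set_rangeI)
  fix p' k assume sub: "core p ` {..pfst p} \<subseteq> gadget Q (pr p' k)"
  then have p': "p' = p" by (auto simp: core_in_gadget)
  have "k = 0 \<or> (\<exists>v. refuted Q p (k - 1) v)"
  proof (rule ccontr)
    assume "\<not> ?thesis"
    then have "\<exists>i < pfst p. pfst (dec (k - 1) i) = c" if "c \<le> pfst p" for c
      using that sub[unfolded p'] core_in_gadget[of p c Q p k] by auto
    then have "{..pfst p} \<subseteq> (\<lambda>i. pfst (dec (k - 1) i)) ` {..<pfst p}"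
      by fastforce
    then have "card {..pfst p} \<le> card {..<pfst p}"
      by (rule surj_card_le[rotated]) simp
    then show False by simp
  qed
  then show "gadget Q (pr p' k) = gadget Q (pr p 0)"
    using gadget_refuted[of Q p "k - 1"] p' by (cases k) auto
qed (auto simp: core_in_gadget)

lemma teach_base_lower:
  assumes Q: "\<forall>c. \<exists>u. \<forall>v. \<not> Q p c u v"
    and S: "finite S" "positive_teaching_set S (gadget Q (pr p 0)) (range (gadget Q))"
  shows "pfst p < card S"
proof (rule ccontr)
  assume "\<not> pfst p < card S"
  define C where "C = {c. core p c \<in> S}"
  have C_eq: "C = core p -` S" by (auto simp: C_def)
  have inj: "inj (core p)" by (auto simp: inj_def)
  have fin: "finite C" unfolding C_eq using S(1) inj by (rule finite_vimageI)
  have "card C \<le> card S"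
    unfolding C_eq using card_vimage_inj_on_le[of "core p" UNIV S] inj S(1) by simp
  with \<open>\<not> pfst p < card S\<close> have card: "card C \<le> pfst p" by simp
  from ex_bij_betw_nat_finite[OF fin] obtain h where h: "h ` {..<card C} = C"
    by (auto simp: bij_betw_def atLeast0LessThan)
  from Q obtain u where u: "\<And>c v. \<not> Q p c (u c) v" by metis
  \<comment> \<open>Every core index in \<open>S\<close> is listed with a true counterexample.
    Positions from \<open>card C\<close> on hold other values of \<open>h\<close>, also with their
    counterexamples, so nothing refutes \<open>m\<close>.\<close>
  obtain m where m: "\<forall>i<pfst p. dec m i = pr (h i) (u (h i))"
    using dec_surj[of "pfst p" "\<lambda>i. pr (h i) (u (h i))"] by blast
  have unref: "\<not> refuted Q p m v" for v
    using m u by (auto simp: refuted_def)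
  have S_sub: "S \<subseteq> gadget Q (pr p 0)"
    using S(2) by (simp add: positive_teaching_set_def)
  have "S \<subseteq> gadget Q (pr p (Suc m))"
  proof
    fix y assume y: "y \<in> S"
    with S_sub have y0: "y \<in> gadget Q (pr p 0)" by blast
    then show "y \<in> gadget Q (pr p (Suc m))"
    proof (cases rule: gadget_cases)
      case (1 c)
      with y have "c \<in> h ` {..<card C}" unfolding h by (simp add: C_def)
      then obtain i where "i < card C" "h i = c" by blast
      with m card have "i < pfst p" "pfst (dec m i) = c" by auto
      with 1 show ?thesis by (auto simp: core_in_gadget)
    next
      case (2 n)
      \<comment> \<open>A marker in the base language is refuted and thus lies in every language of
        the gadget.\<close>
      with y0 show ?thesis by (auto simp: marker_in_gadget)
    qed
  qed
  moreover have "gadget Q (pr p (Suc m)) \<noteq> gadget Q (pr p 0)"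
  proof -
    have "marker p m \<in> gadget Q (pr p (Suc m))" "marker p m \<notin> gadget Q (pr p 0)"
      using unref by (auto simp: marker_in_gadget)
    then show ?thesis by metis
  qed
  ultimately show False
    using S(2) by (auto simp: positive_teaching_set_def)
qed

lemma TD_gadget_finite_iff:
  "TD_pos_family (range (gadget Q)) < \<infinity> \<longleftrightarrow>
    (\<exists>d. \<forall>p. d < pfst p \<longrightarrow> (\<exists>c. \<forall>u. \<exists>v. Q p c u v))"
  unfolding TD_pos_family_finite_iff
proof
  assume "\<exists>d. \<forall>L\<in>range (gadget Q). \<exists>S. finite S \<and> card S \<le> d \<and>
    positive_teaching_set S L (range (gadget Q))"
  then obtain d where d: "\<And>j. \<exists>S. finite S \<and> card S \<le> d \<and>
    positive_teaching_set S (gadget Q j) (range (gadget Q))" by auto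
  have "\<exists>c. \<forall>u. \<exists>v. Q p c u v" if "d < pfst p" for p
  proof (rule ccontr)
    assume "\<nexists>c. \<forall>u. \<exists>v. Q p c u v"
    then have "\<forall>c. \<exists>u. \<forall>v. \<not> Q p c u v" by blast
    from teach_base_lower[of Q, OF this] d[of "pr p 0"] that show False by fastforce
  qed
  then show "\<exists>d. \<forall>p. d < pfst p \<longrightarrow> (\<exists>c. \<forall>u. \<exists>v. Q p c u v)" by blast
next
  assume "\<exists>d. \<forall>p. d < pfst p \<longrightarrow> (\<exists>c. \<forall>u. \<exists>v. Q p c u v)"
  then obtain d where d: "\<And>p. d < pfst p \<Longrightarrow> \<exists>c. \<forall>u. \<exists>v. Q p c u v" by blast
  \<comment> \<open>Gadgets with \<open>pfst p\<close> above \<open>d\<close> need one element, the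
    others at most \<open>Suc (pfst p)\<close>; \<open>Suc d\<close> covers both.\<close>
  have base: "\<exists>S. finite S \<and> card S \<le> Suc d \<and>
      positive_teaching_set S (gadget Q (pr p 0)) (range (gadget Q))" for p
  proof (cases "d < pfst p")
    case True
    with d obtain c where "\<forall>u. \<exists>v. Q p c u v" by blast
    from teach_base_singleton[of Q, OF this] show ?thesis
      by (intro exI[of _ "{core p c}"]) simp
  next
    case False
    have "card (core p ` {..pfst p}) = Suc (pfst p)"
      by (subst card_image) (auto simp: inj_on_def)
    with False teach_base[of p Q] show ?thesis
      by (intro exI[of _ "core p ` {..pfst p}"]) simp
  qed
  have "\<exists>S. finite S \<and> card S \<le> Suc d \<and>
      positive_teaching_set S (gadget Q (pr p k)) (range (gadget Q))" for p k
  proof (cases k)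
    case 0
    then show ?thesis using base by simp
  next
    case (Suc m)
    show ?thesis
    proof (cases "\<exists>v. refuted Q p m v")
      case True
      then show ?thesis using base gadget_refuted Suc by metis
    next
      case False
      from teach_unrefuted[OF this] Suc show ?thesis
        by (intro exI[of _ "{marker p m}"]) simp
    qed
  qed
  then have "\<exists>S. finite S \<and> card S \<le> Suc d \<and>
      positive_teaching_set S (gadget Q j) (range (gadget Q))" for j
    by (metis pr_pfst_psnd)
  then show "\<exists>d. \<forall>L\<in>range (gadget Q). \<exists>S. finite S \<and> card S \<le> d \<and>
    positive_teaching_set S L (range (gadget Q))" by blast
qed

section \<open>The reduction\<close>

lemma many_one_I_TD_pos:
  assumes W: "acceptable_numbering W" and B: "Sigma0_set 5 B"
  shows "B \<le>\<^sub>m I_TD_pos W"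
proof -
  obtain P where B_eq: "B = {x. \<exists>a. \<forall>b. \<exists>c. \<forall>u. \<exists>v. P x a b c u v}"
    and P: "\<And>f0 f1 f2 f3 f4 f5. \<lbrakk>recursive1 f0; recursive1 f1; recursive1 f2; recursive1 f3;
      recursive1 f4; recursive1 f5\<rbrakk> \<Longrightarrow> decidable (\<lambda>z. P (f0 z) (f1 z) (f2 z) (f3 z) (f4 z) (f5 z))"
    using that by (rule Sigma0_set_5E[OF B])
  \<comment> \<open>\<open>c\<close> packs an index \<open>a'\<close> with its own witness, so the
    bounded quantifier over \<open>a'\<close> merges with the one over \<open>c\<close>;
    \<open>psnd p\<close> codes the sequence of challenges.\<close>
  define Q where "Q x p c u v \<longleftrightarrow> pfst c \<le> pfst p \<and>
    P x (pfst c) (dec (psnd p) (pfst c)) (psnd c) u v" for x p c u v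
  have ex_Q: "(\<exists>c. \<forall>u. \<exists>v. Q x (pr a s) c u v) \<longleftrightarrow>
      (\<exists>a'\<le>a. \<exists>c. \<forall>u. \<exists>v. P x a' (dec s a') c u v)" for x a s
    using ex_pair[of "\<lambda>a' c. \<forall>u. \<exists>v. a' \<le> a \<and> P x a' (dec s a') c u v"]
    unfolding Q_def by auto
  have red: "x \<in> B \<longleftrightarrow> TD_pos_family (range (gadget (Q x))) < \<infinity>" for x
    unfolding TD_gadget_finite_iff
  proof
    assume "x \<in> B"
    then obtain a where a: "\<forall>b. \<exists>c. \<forall>u. \<exists>v. P x a b c u v" by (auto simp: B_eq)
    have "\<exists>c. \<forall>u. \<exists>v. Q x (pr a' s) c u v" if "a < a'" for a' s
      unfolding ex_Q using a that less_imp_le by blast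
    then show "\<exists>d. \<forall>p. d < pfst p \<longrightarrow> (\<exists>c. \<forall>u. \<exists>v. Q x p c u v)"
      by (metis pr_pfst_psnd)
  next
    assume "\<exists>d. \<forall>p. d < pfst p \<longrightarrow> (\<exists>c. \<forall>u. \<exists>v. Q x p c u v)"
    then obtain d where "\<And>p. d < pfst p \<Longrightarrow> \<exists>c. \<forall>u. \<exists>v. Q x p c u v" by blast
    from this[of "pr (Suc d) s" for s]
    have d: "\<exists>a\<le>Suc d. \<exists>c. \<forall>u. \<exists>v. P x a (dec s a) c u v" for s
      unfolding ex_Q by simp
    show "x \<in> B"
    proof (rule ccontr)
      assume "x \<notin> B"
      then have "\<forall>a. \<exists>b. \<not> (\<exists>c. \<forall>u. \<exists>v. P x a b c u v)" by (auto simp: B_eq)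
      then obtain b where b: "\<And>a. \<not> (\<exists>c. \<forall>u. \<exists>v. P x a (b a) c u v)" by metis
      \<comment> \<open>One sequence collects counterexamples to all candidates up to
        \<open>Suc d\<close>, so the gadget for it has no witness.\<close>
      obtain s where "\<forall>a<Suc (Suc d). dec s a = b a" using dec_surj by blast
      moreover obtain a where "a \<le> Suc d" "\<exists>c. \<forall>u. \<exists>v. P x a (dec s a) c u v"
        using d by blast
      ultimately show False using b[of a] by (simp add: less_Suc_eq_le)
    qed
  qed
  \<comment> \<open>\<open>V x\<close> codes the whole family of \<open>x\<close> as one r.e. set;
    acceptability then turns \<open>x\<close> into an index recursively.\<close>
  define V where "V x = {y. psnd y \<in> gadget (Q x) (pfst y)}" for x
  have "{pr x y | x y. y \<in> V x} = {z. \<exists>v. pfst (pfst (psnd z)) = pfst (psnd (psnd z)) \<and>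
      gadget_at (Q (pfst z)) (pfst (pfst (psnd z))) (psnd (pfst (psnd z)))
        (pfst (psnd (psnd (psnd z)))) (psnd (psnd (psnd (psnd z)))) v}" (is "?lhs = ?rhs")
  proof (intro set_eqI)
    fix z
    have "z \<in> ?lhs \<longleftrightarrow> psnd z \<in> V (pfst z)" by (auto; metis pr_pfst_psnd)
    then show "z \<in> ?lhs \<longleftrightarrow> z \<in> ?rhs" by (simp add: V_def gadget_def)
  qed
  moreover have "re_set ?rhs"
    unfolding gadget_at_def refuted_def Q_def
    by (intro re_set_projection recursive P)
  ultimately have "uniformly_re V" by (simp add: uniformly_re_def)
  with W obtain f where f: "recursive1 f" "\<And>x. V x = W (f x)"
    unfolding acceptable_numbering_def by blast
  have "lang_family W (f x) = range (gadget (Q x))" for x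
    by (simp add: lang_family_def lang_def f(2)[symmetric] V_def)
  then have "x \<in> B \<longleftrightarrow> f x \<in> I_TD_pos W" for x
    by (simp add: red I_TD_pos_def)
  with f(1) show ?thesis unfolding many_one_reducible_def by blast
qed

theorem theorem9:
  fixes W :: "nat \<Rightarrow> nat set"
  assumes "acceptable_numbering W"
  shows "Sigma0_complete 5 (I_TD_pos W)"
  unfolding Sigma0_complete_def
  using Sigma0_set_I_TD_pos[OF assms] many_one_I_TD_pos[OF assms] by blast

end
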